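(* Let $A$ be a $k\times k$ matrix with characteristic polynomial $P$. For $0\le j\le k-1$ let $G_j(z)$ be defined by $$G_j(z)=\sum_{n\ge 0}b_j(n+k)\frac{z^n}{n!}.$$ Then $$G_j(z)=-\frac{1}{2\pi \mathrm{i}}\int_{c-\mathrm{i}\infty}^{c+\mathrm{i}\infty}s^{k-j-1}\,\frac{p_j(s)}{P(s)}\,e^{zs}\,ds,$$ where $c>\rho(A)$ and $$p_j(s)=\sum_{l=0}^{j}a_l s^{l},\qquad 0\le j\le k-1.$$
   Context: Write the characteristic polynomial of the $k\times k$ matrix $A$ as $P(x)=x^{k}+\sum_{j=0}^{k-1}a_jx^{j}$; this defines the coefficients $a_j$. The numbers $b_j(n)$, for $0\le j\le k-1$ and integers $n\ge k$, are defined recursively by $b_j(k)=-a_j$ for $0\le j\le k-1$, the convention $b_{-1}(n)=0$ for $n\ge k$, and $b_j(n+1)=b_{j-1}(n)-a_j\,b_{k-1}(n)$ for $n\ge k$, $0\le j\le k-1$. (They satisfy $A^n=\sum_{j=0}^{k-1}b_j(n)A^j$ for $n\ge k$.) The spectral radius is $\rho(A)=\max\{|\mu| : P(\mu)=0\}$. The integral is the Bromwich (inverse Laplace transform) integral along the vertical line $\operatorname{Re}s=c$.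
   Formalization: The formula is proved for real z > 0, with the integral taken as the limit over symmetric segments; no range of z was given, and for A=(1), G_0(z)=e^z the formula fails at z=0 and for z<0, and the integral diverges for non-real z. *)

theory Defs
  imports
    "HOL-Complex_Analysis.Contour_Integration"
    "Jordan_Normal_Form.Spectral_Radius"
begin

text \<open>
  \<^const>\<open>spectral_radius\<close> is defined through eigenvalues; for a nonempty square complex matrix it is the
  largest modulus of a root of the characteristic polynomial.
\<close>

lemma spectral_radius_char_poly:
  fixes A :: "complex mat"
  assumes "A \<in> carrier_mat k k"
  shows "spectral_radius A = Max {cmod \<mu> |\<mu>. poly (char_poly A) \<mu> = 0}"
proof -
  have "norm ` spectrum A = {cmod \<mu> |\<mu>. poly (char_poly A) \<mu> = 0}"
    using eigenvalue_root_char_poly[OF assms] by (auto simp: spectrum_def)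
  then show ?thesis by (simp add: spectral_radius_def)
qed

text \<open>
  \<open>power_coeff A j n\<close> is \<open>b\<^sub>j(n)\<close>, the coefficient of \<open>A\<^sup>j\<close> in the reduction of \<open>A\<^sup>n\<close> modulo the
  characteristic polynomial. Only arguments \<open>j < k\<close> and \<open>n \<ge> k\<close> are meaningful, where \<open>k = dim_row A\<close>;
  the branch \<open>j = 0\<close> realises the convention \<open>b\<^sub>-\<^sub>1 = 0\<close>.
\<close>

fun power_coeff :: "complex mat \<Rightarrow> nat \<Rightarrow> nat \<Rightarrow> complex" where
  "power_coeff A j n =
    (if n \<le> dim_row A then - coeff (char_poly A) j
     else (if j = 0 then 0 else power_coeff A (j - 1) (n - 1))
          - coeff (char_poly A) j * power_coeff A (dim_row A - 1) (n - 1))"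

declare power_coeff.simps [simp del]

lemma power_coeff_init:
  assumes "A \<in> carrier_mat k k"
  shows "power_coeff A j k = - coeff (char_poly A) j"
  using assms by (simp add: power_coeff.simps)

lemma power_coeff_rec:
  assumes "A \<in> carrier_mat k k" "n \<ge> k"
  shows "power_coeff A j (Suc n) =
    (if j = 0 then 0 else power_coeff A (j - 1) n)
    - coeff (char_poly A) j * power_coeff A (k - 1) n"
  using assms by (subst power_coeff.simps) auto

definition power_coeff_gen :: "complex mat \<Rightarrow> nat \<Rightarrow> complex \<Rightarrow> complex" where
  "power_coeff_gen A j z = (\<Sum>n. power_coeff A j (n + dim_row A) * z ^ n / fact n)"

definition char_poly_trunc :: "complex mat \<Rightarrow> nat \<Rightarrow> complex \<Rightarrow> complex" where
  "char_poly_trunc A j s = (\<Sum>l=0..j. coeff (char_poly A) l * s ^ l)"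

text \<open>
  The integral along the vertical line \<open>Re s = c\<close> is the limit of the integrals over the symmetric
  segments from \<open>c - \<i>T\<close> to \<open>c + \<i>T\<close>, as usual for the inverse Laplace transform; it need
  not converge absolutely.
\<close>

definition has_bromwich_integral ::
    "(complex \<Rightarrow> complex) \<Rightarrow> complex \<Rightarrow> real \<Rightarrow> bool" where
  "has_bromwich_integral f I c \<longleftrightarrow>
    (\<forall>T>0. f contour_integrable_on linepath (Complex c (- T)) (Complex c T)) \<and>
    ((\<lambda>T. contour_integral (linepath (Complex c (- T)) (Complex c T)) f) \<longlongrightarrow> I) at_top"

definition bromwich_integrable :: "(complex \<Rightarrow> complex) \<Rightarrow> real \<Rightarrow> bool" where
  "bromwich_integrable f c \<longleftrightarrow> (\<exists>I. has_bromwich_integral f I c)"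

definition bromwich_integral :: "real \<Rightarrow> (complex \<Rightarrow> complex) \<Rightarrow> complex" where
  "bromwich_integral c f = (THE I. has_bromwich_integral f I c)"

lemma bromwich_integral_unique:
  "has_bromwich_integral f I c \<Longrightarrow> bromwich_integral c f = I"
  unfolding bromwich_integral_def has_bromwich_integral_def
  by (rule the_equality) (auto intro: tendsto_unique[OF trivial_limit_at_top_linorder])

end

theory Submission
  imports Defs "HOL-Complex_Analysis.Cauchy_Integral_Formula"
begin

text \<open>
  Write $b_n$ for $b_j(n+k)$ and $F(s) = s^{k-j-1} p_j(s)/P(s)$. The formula says that $-F$ is the
  Laplace transform of the entire function $G_j(z) = \sum_n b_n z^n/n!$, and it is the inversion of
  the termwise statement that $z^n/n!$ has Laplace transform $s^{-n-1}$. Two facts carry it.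

  The algebraic one is the expansion $F(s) = -\sum_n b_n s^{-n-1}$, absolutely convergent for
  $|s| > \rho(A)$. Multiplied by $X^{n+1}$ and summed, the recursion for the $b_j$ becomes
  $B_j = X B_{j-1} - a_j (1 + X B_{k-1})$ for the formal series $B_j = \sum_n b_j(n+k) X^n$. All $B_j$ are
  therefore polynomial multiples of the single series $Q = 1 + X B_{k-1}$, and the equation for $j = k-1$
  determines $Q$ as the inverse of the reversed polynomial $X^k P(1/X)$
  (\<open>power_coeff_fps\<close>). That polynomial has no zero with $|w| < 1/\rho(A)$, so $B_j$ converges
  there; $w = 1/s$ gives the expansion (\<open>power_coeff_inverse_power_series\<close>).

  The analytic one is \<open>has_bromwich_integral_inverse_power_series\<close>: a series
  $\sum_n b_n s^{-n-1}$ that converges absolutely at $s = c > 0$ may be inverted termwise. On the line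
  $\operatorname{Re} s = c$ we have $|s| \ge c$, so the series converges uniformly and may be
  integrated termwise over each segment. The segment from $c - iT$ to $c + iT$ is one side of a rectangle
  around 0, over which $e^{zs} s^{-n-1}$ has integral $2\pi i z^n/n!$; the three other sides, at distance
  at least $T$ from 0, contribute at most $6 e^{cz}/T^n$. This vanishes as $T \to \infty$ for
  $n \ge 1$, also after summation over $n$. For $n = 0$ it does not, and there
  one integration by parts, which divides by $z > 0$, reduces $n = 0$ to $n = 1$.
\<close>

section \<open>The kernel on rectangles\<close>

definition laplace_kernel :: "real \<Rightarrow> nat \<Rightarrow> complex \<Rightarrow> complex" where
  "laplace_kernel z n s = exp (of_real z * s) / s ^ Suc n"

lemma continuous_on_laplace_kernel:
  assumes "0 \<notin> S"
  shows "continuous_on S (laplace_kernel z n)"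
  unfolding laplace_kernel_def by (intro continuous_intros) (use assms in auto)

lemma laplace_kernel_has_field_derivative:
  assumes "s \<noteq> 0"
  shows "(laplace_kernel z n has_field_derivative
           of_real z * laplace_kernel z n s - of_nat (Suc n) * laplace_kernel z (Suc n) s)
         (at s within S)"
proof -
  have pow: "((\<lambda>s. s ^ Suc n) has_field_derivative of_nat (Suc n) * s ^ n) (at s within S)"
    using DERIV_power_Suc[OF DERIV_ident[of "at s within S"], of n] by simp
  have "((\<lambda>s. exp (of_real z * s) / s ^ Suc n) has_field_derivative
          (exp (of_real z * s) * of_real z * s ^ Suc n
            - exp (of_real z * s) * (of_nat (Suc n) * s ^ n)) / (s ^ Suc n * s ^ Suc n))
        (at s within S)"
    by (rule DERIV_divide[OF _ pow]) (use assms in \<open>auto intro!: derivative_eq_intros\<close>)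
  also have "(exp (of_real z * s) * of_real z * s ^ Suc n
            - exp (of_real z * s) * (of_nat (Suc n) * s ^ n)) / (s ^ Suc n * s ^ Suc n) =
      of_real z * laplace_kernel z n s - of_nat (Suc n) * laplace_kernel z (Suc n) s"
    using assms unfolding laplace_kernel_def by (simp add: divide_simps) (simp add: algebra_simps)
  finally show ?thesis
    unfolding laplace_kernel_def[abs_def] .
qed

text \<open>
  Integration by parts along a path. For closed paths it computes all kernels from $n = 0$; for
  the vertical segment it is read backwards, to gain decay for $n = 0$.
\<close>

lemma laplace_kernel_contour_parts:
  assumes "valid_path g" "0 \<notin> path_image g"
    and "(laplace_kernel z n has_contour_integral I) g"
  shows "(laplace_kernel z (Suc n) has_contour_integral
           (of_real z * I - (laplace_kernel z n (pathfinish g) - laplace_kernel z n (pathstart g)))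
             / of_nat (Suc n)) g"
proof -
  have "((\<lambda>s. of_real z * laplace_kernel z n s - of_nat (Suc n) * laplace_kernel z (Suc n) s)
      has_contour_integral
      laplace_kernel z n (pathfinish g) - laplace_kernel z n (pathstart g)) g"
    by (rule contour_integral_primitive[where S = "path_image g"])
      (use assms in \<open>auto intro!: laplace_kernel_has_field_derivative simp del: of_nat_Suc\<close>)
  from has_contour_integral_div[OF has_contour_integral_diff[OF
      has_contour_integral_lmul[OF assms(3), of "of_real z"] this], of "of_nat (Suc n)"]
  show ?thesis
    by (simp del: of_nat_Suc)
qed

text \<open>
  For $n = 0$ this is Cauchy's integral formula at 0 for $e^{zs}$. In the induction step the boundary
  term of the integration by parts vanishes because the path is closed.
\<close>

lemma laplace_kernel_rectpath:
  assumes "0 \<in> box a b"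
  shows "(laplace_kernel z n has_contour_integral 2 * of_real pi * \<i> * (of_real z ^ n / fact n))
         (rectpath a b)"
proof -
  have le: "Re a \<le> Re b" "Im a \<le> Im b"
    using assms by (auto simp: in_box_complex_iff)
  have nz: "0 \<notin> path_image (rectpath a b)"
    using assms path_image_rectpath_inter_box[OF le] by auto
  show ?thesis
  proof (induction n)
    case 0
    have "((\<lambda>s. exp (of_real z * s) / (s - 0)) has_contour_integral
        2 * pi * \<i> * winding_number (rectpath a b) 0 * exp (of_real z * 0)) (rectpath a b)"
      by (rule Cauchy_integral_formula_convex_simple[where S = UNIV])
        (use nz in \<open>auto intro!: holomorphic_intros\<close>)
    then show ?case
      using winding_number_rectpath[OF assms] by (simp add: laplace_kernel_def[abs_def])
  next
    case (Suc n)
    from laplace_kernel_contour_parts[OF _ nz Suc.IH] show ?case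
      by (simp add: field_simps)
  qed
qed

lemma laplace_kernel_linepath_bound:
  assumes "z \<ge> 0" "T > 0"
    and "\<And>s. s \<in> closed_segment a b \<Longrightarrow> Re s \<le> c \<and> T \<le> cmod s"
  shows "cmod (contour_integral (linepath a b) (laplace_kernel z n))
           \<le> exp (c * z) / T ^ Suc n * cmod (b - a)"
proof (rule has_contour_integral_bound_linepath)
  have "0 \<notin> closed_segment a b"
    using assms(2,3) by force
  then show "(laplace_kernel z n has_contour_integral
      contour_integral (linepath a b) (laplace_kernel z n)) (linepath a b)"
    by (intro has_contour_integral_integral contour_integrable_continuous_linepath
        continuous_on_laplace_kernel)
next
  fix s assume "s \<in> closed_segment a b"
  from assms(3)[OF this] have "Re s \<le> c" "T \<le> cmod s"
    by auto
  then have "Re s * z \<le> c * z" "T ^ Suc n \<le> cmod s ^ Suc n"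
    using assms(1,2) by (blast intro: mult_right_mono power_mono less_imp_le)+
  then show "cmod (laplace_kernel z n s) \<le> exp (c * z) / T ^ Suc n"
    unfolding laplace_kernel_def norm_divide norm_power norm_exp_eq_Re
    using assms(2) by (intro frac_le) (auto simp: mult.commute)
qed (use assms in auto)

section \<open>The kernel on a vertical segment\<close>

abbreviation vertical_segment :: "real \<Rightarrow> real \<Rightarrow> real \<Rightarrow> complex" where
  "vertical_segment c T \<equiv> linepath (Complex c (- T)) (Complex c T)"

lemma vertical_segment_Re:
  assumes "s \<in> closed_segment (Complex c (- T)) (Complex c T)"
  shows "Re s = c"
  using assms by (simp add: closed_segment_same_Re)

lemma zero_notin_vertical_segment:
  assumes "c > 0"
  shows "0 \<notin> closed_segment (Complex c (- T)) (Complex c T)"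
  using vertical_segment_Re[of 0 c T] assms by auto

lemma laplace_kernel_integrable_vertical:
  assumes "c > 0"
  shows "laplace_kernel z n contour_integrable_on vertical_segment c T"
  by (intro contour_integrable_continuous_linepath continuous_on_laplace_kernel
      zero_notin_vertical_segment assms)

text \<open>
  The segment is completed to a rectangle reaching left to $\operatorname{Re} s = -T$. The
  three added sides have total length at most $6T$, and on them $|e^{zs}| \le e^{cz}$ and $|s| \ge T$.
\<close>

lemma laplace_kernel_vertical_error:
  assumes "0 < c" "c \<le> T" "0 \<le> z"
  shows "cmod (contour_integral (vertical_segment c T) (laplace_kernel z n)
           - 2 * of_real pi * \<i> * (of_real z ^ n / fact n)) \<le> 6 * exp (c * z) / T ^ n"
proof -
  define a1 a2 a3 a4 where "a1 = Complex (- T) (- T)" and "a2 = Complex c (- T)"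
    and "a3 = Complex c T" and "a4 = Complex (- T) T"
  note a_defs = a1_def a2_def a3_def a4_def
  let ?J = "\<lambda>a b. contour_integral (linepath a b) (laplace_kernel z n)"
  have T: "T > 0"
    using assms by simp
  have far: "Re s \<le> c \<and> T \<le> cmod s" if "s \<in> closed_segment a1 a2 \<union> closed_segment a3 a4 \<union> closed_segment a4 a1" for s
  proof -
    have "Re s \<le> c \<and> (\<bar>Re s\<bar> = T \<or> \<bar>Im s\<bar> = T)"
      using that assms
      by (auto simp: a_defs closed_segment_same_Re closed_segment_same_Im closed_segment_eq_real_ivl)
    then show ?thesis
      using abs_Re_le_cmod[of s] abs_Im_le_cmod[of s] by auto
  qed
  have int: "laplace_kernel z n contour_integrable_on linepath a b"
    if "(a, b) \<in> {(a1, a2), (a2, a3), (a3, a4), (a4, a1)}" for a b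
  proof (intro contour_integrable_continuous_linepath continuous_on_laplace_kernel)
    show "0 \<notin> closed_segment a b"
      using that far[of 0] T zero_notin_vertical_segment[OF assms(1), of T]
      by (auto simp: a2_def[symmetric] a3_def[symmetric])
  qed
  have "0 \<in> box a1 a3"
    using assms by (auto simp: a_defs in_box_complex_iff)
  from contour_integral_unique[OF laplace_kernel_rectpath[OF this, of z n]]
  have "contour_integral (rectpath a1 a3) (laplace_kernel z n) = 2 * of_real pi * \<i> * (of_real z ^ n / fact n)" .
  moreover have "rectpath a1 a3 = linepath a1 a2 +++ linepath a2 a3 +++ linepath a3 a4 +++ linepath a4 a1"
    by (simp add: rectpath_def Let_def a_defs)
  then have "contour_integral (rectpath a1 a3) (laplace_kernel z n)
      = ?J a1 a2 + (?J a2 a3 + (?J a3 a4 + ?J a4 a1))"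
    by (simp add: int contour_integrable_joinI)
  ultimately have "2 * of_real pi * \<i> * (of_real z ^ n / fact n)
      = ?J a1 a2 + (?J a2 a3 + (?J a3 a4 + ?J a4 a1))"
    by (rule trans[OF sym])
  then have "2 * of_real pi * \<i> * (of_real z ^ n / fact n) - ?J a2 a3 = ?J a1 a2 + ?J a3 a4 + ?J a4 a1"
    by (simp only: diff_eq_eq ac_simps)
  then have "cmod (?J a2 a3 - 2 * of_real pi * \<i> * (of_real z ^ n / fact n))
      = cmod (?J a1 a2 + ?J a3 a4 + ?J a4 a1)"
    by (subst norm_minus_commute) (simp only:)
  also have "\<dots> \<le> cmod (?J a1 a2) + cmod (?J a3 a4) + cmod (?J a4 a1)"
    by (intro norm_triangle_le add_mono) auto
  also have "\<dots> \<le> exp (c * z) / T ^ Suc n * cmod (a2 - a1) + exp (c * z) / T ^ Suc n * cmod (a4 - a3)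
      + exp (c * z) / T ^ Suc n * cmod (a1 - a4)"
    by (intro add_mono laplace_kernel_linepath_bound assms T far) auto
  also have "\<dots> = exp (c * z) / T ^ Suc n * (cmod (a2 - a1) + cmod (a4 - a3) + cmod (a1 - a4))"
    by (simp only: distrib_left)
  also have "\<dots> \<le> exp (c * z) / T ^ Suc n * (6 * T)"
  proof (intro mult_left_mono)
    show "cmod (a2 - a1) + cmod (a4 - a3) + cmod (a1 - a4) \<le> 6 * T"
      using assms by (simp add: a_defs cmod_def real_sqrt_mult)
  qed (use T in auto)
  also have "\<dots> = 6 * exp (c * z) / T ^ n"
    using T by simp
  finally show ?thesis
    by (simp add: a_defs)
qed

text \<open>
  The integrand decays only like $1/|s|$, so the rectangle estimate gives no limit. Integration by parts
  expresses the integral through that of $e^{zs}/s^2$, which tends to $2\pi i z$, and boundary terms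
  that vanish at $c \pm iT$.
\<close>

lemma laplace_kernel_vertical_limit_0:
  assumes "c > 0" "z > 0"
  shows "((\<lambda>T. contour_integral (vertical_segment c T) (laplace_kernel z 0)) \<longlongrightarrow> 2 * of_real pi * \<i>) at_top"
proof -
  let ?J = "\<lambda>n T. contour_integral (vertical_segment c T) (laplace_kernel z n)"
  let ?K = "\<lambda>T. laplace_kernel z 0 (Complex c T)"
  have parts: "?J 0 T = (?J 1 T + (?K T - ?K (- T))) / of_real z" for T
  proof -
    have "(laplace_kernel z (Suc 0) has_contour_integral
        (of_real z * ?J 0 T - (?K T - ?K (- T))) / of_nat (Suc 0)) (vertical_segment c T)"
      using laplace_kernel_contour_parts[OF _ _ has_contour_integral_integral[OF
          laplace_kernel_integrable_vertical[OF assms(1), of z 0 T]]]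
        zero_notin_vertical_segment[OF assms(1)] by simp
    from contour_integral_unique[OF this] show ?thesis
      using assms(2) by (simp add: field_simps)
  qed
  have "((\<lambda>T. ?J 1 T - 2 * of_real pi * \<i> * of_real z) \<longlongrightarrow> 0) at_top"
  proof (rule Lim_null_comparison)
    show "\<forall>\<^sub>F T in at_top. cmod (?J 1 T - 2 * of_real pi * \<i> * of_real z) \<le> 6 * exp (c * z) / T"
      using eventually_ge_at_top[of c]
    proof eventually_elim
      case (elim T)
      with laplace_kernel_vertical_error[of c T z 1] assms show ?case
        by simp
    qed
    show "((\<lambda>T. 6 * exp (c * z) / T) \<longlongrightarrow> 0) at_top"
      by (intro tendsto_divide_0[OF tendsto_const] filterlim_at_top_imp_at_infinity filterlim_ident)
  qed
  then have lim1: "(?J 1 \<longlongrightarrow> 2 * of_real pi * \<i> * of_real z) at_top"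
    by (rule LIM_zero_cancel)
  have K: "cmod (?K T) \<le> exp (c * z) / \<bar>T\<bar>" if "T \<noteq> 0" for T
    using that abs_Im_le_cmod[of "Complex c T"]
    by (auto simp: laplace_kernel_def norm_divide mult.commute intro!: divide_left_mono mult_pos_pos)
  have inv: "((\<lambda>T. exp (c * z) / T) \<longlongrightarrow> 0) at_top"
    by (intro tendsto_divide_0[OF tendsto_const] filterlim_at_top_imp_at_infinity filterlim_ident)
  have "((\<lambda>T. ?K T) \<longlongrightarrow> 0) at_top"
  proof (rule Lim_null_comparison[OF eventually_mono[OF eventually_gt_at_top[of 0]] inv])
    show "cmod (?K T) \<le> exp (c * z) / T" if "T > 0" for T
      using K[of T] that by simp
  qed
  moreover have "((\<lambda>T. ?K (- T)) \<longlongrightarrow> 0) at_top"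
  proof (rule Lim_null_comparison[OF eventually_mono[OF eventually_gt_at_top[of 0]] inv])
    show "cmod (?K (- T)) \<le> exp (c * z) / T" if "T > 0" for T
      using K[of "- T"] that by simp
  qed
  ultimately have "((\<lambda>T. (?J 1 T + (?K T - ?K (- T))) / of_real z) \<longlongrightarrow>
      (2 * of_real pi * \<i> * of_real z + (0 - 0)) / of_real z) at_top"
    using lim1 assms(2) by (intro tendsto_intros) auto
  moreover have "?J 0 = (\<lambda>T. (?J 1 T + (?K T - ?K (- T))) / of_real z)"
    by (intro ext parts)
  ultimately show ?thesis
    using assms(2) by simp
qed

section \<open>Series in inverse powers\<close>

lemma power_div_fact_le_exp:
  fixes x :: real
  assumes "x \<ge> 0"
  shows "x ^ n / fact n \<le> exp x"
proof -
  have "(\<Sum>k\<in>{n}. x ^ k /\<^sub>R fact k) \<le> exp x"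
    unfolding exp_def by (rule sum_le_suminf) (use assms summable_exp_generic[of x] in auto)
  then show ?thesis
    by (simp add: divide_inverse mult.commute)
qed

text \<open>
  Each factor $(c|w|)^n/n!$ is at most $e^{c|w|}$, so dividing by $n!$ turns convergence at one
  positive radius into convergence everywhere.
\<close>

lemma summable_borel_transform:
  fixes b :: "nat \<Rightarrow> complex"
  assumes "c > 0" "summable (\<lambda>n. cmod (b n) / c ^ n)"
  shows "summable (\<lambda>n. b n * w ^ n / fact n)"
proof (rule summable_comparison_test')
  show "summable (\<lambda>n. exp (c * cmod w) * (cmod (b n) / c ^ n))"
    by (intro summable_mult assms)
  fix n :: nat
  have "cmod (b n * w ^ n / fact n) = (c * cmod w) ^ n / fact n * (cmod (b n) / c ^ n)"
    using assms(1) by (simp add: norm_mult norm_divide norm_power power_mult_distrib)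
  also have "\<dots> \<le> exp (c * cmod w) * (cmod (b n) / c ^ n)"
    using assms(1) by (intro mult_right_mono power_div_fact_le_exp) auto
  finally show "cmod (b n * w ^ n / fact n) \<le> exp (c * cmod w) * (cmod (b n) / c ^ n)" .
qed

text \<open>
  On the whole line $|s| \ge c$ and $|e^{zs}| = e^{cz}$, so the terms have the summable majorant
  $e^{cz} |b_n| / c^{n+1}$, uniformly in $s$.
\<close>

lemma vertical_integral_termwise:
  fixes b :: "nat \<Rightarrow> complex"
  assumes c: "c > 0" and b: "summable (\<lambda>n. cmod (b n) / c ^ n)"
    and F: "\<And>s. Re s = c \<Longrightarrow> (\<lambda>n. b n / s ^ Suc n) sums F s"
  shows "(\<lambda>s. F s * exp (of_real z * s)) contour_integrable_on vertical_segment c T"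
    and "(\<lambda>n. b n * contour_integral (vertical_segment c T) (laplace_kernel z n)) sums
           contour_integral (vertical_segment c T) (\<lambda>s. F s * exp (of_real z * s))"
proof -
  let ?g = "vertical_segment c T"
  let ?G = "\<lambda>N s. \<Sum>n<N. b n * laplace_kernel z n s"
  have bound: "cmod (b n * laplace_kernel z n s) \<le> exp (c * z) / c * (cmod (b n) / c ^ n)"
    if "Re s = c" for n s
  proof -
    have "c ^ Suc n \<le> cmod s ^ Suc n"
      using that c complex_Re_le_cmod[of s] by (intro power_mono) auto
    then have "cmod (laplace_kernel z n s) \<le> exp (c * z) / c ^ Suc n"
      unfolding laplace_kernel_def norm_divide norm_power norm_exp_eq_Re
      using that c by (intro frac_le) (auto simp: mult.commute)
    from mult_left_mono[OF this norm_ge_zero[of "b n"]] show ?thesis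
      by (simp add: norm_mult field_simps)
  qed
  have line: "Re s = c" if "s \<in> path_image ?g" for s
    using that vertical_segment_Re by simp
  have sum_eq: "(\<Sum>n. b n * laplace_kernel z n s) = F s * exp (of_real z * s)" if "Re s = c" for s
    using sums_mult2[OF F[OF that], of "exp (of_real z * s)"]
    by (simp add: laplace_kernel_def sums_iff)
  have majorant: "summable (\<lambda>n. exp (c * z) / c * (cmod (b n) / c ^ n))"
    by (intro summable_mult b)
  have "uniform_limit (path_image ?g) ?G (\<lambda>s. \<Sum>n. b n * laplace_kernel z n s) sequentially"
    by (rule Weierstrass_m_test[where M = "\<lambda>n. exp (c * z) / c * (cmod (b n) / c ^ n)"])
      (blast intro: bound line majorant)+
  then have lim: "uniform_limit (path_image ?g) ?G (\<lambda>s. F s * exp (of_real z * s)) sequentially"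
    by (rule uniform_limit_cong'[THEN iffD1, rotated 2]) (use sum_eq line in auto)
  have int: "(\<lambda>s. b n * laplace_kernel z n s) contour_integrable_on ?g" for n
    by (intro contour_integrable_lmul laplace_kernel_integrable_vertical c)
  note limits = contour_integral_uniform_limit[OF always_eventually lim,
      where B = "cmod (Complex c T - Complex c (- T))"]
  show "(\<lambda>s. F s * exp (of_real z * s)) contour_integrable_on ?g"
    by (rule limits(1)) (auto intro!: contour_integrable_sum int)
  have "(\<lambda>N. contour_integral ?g (?G N)) \<longlonglongrightarrow> contour_integral ?g (\<lambda>s. F s * exp (of_real z * s))"
    by (rule limits(2)) (auto intro!: contour_integrable_sum int)
  then show "(\<lambda>n. b n * contour_integral ?g (laplace_kernel z n)) sums
      contour_integral ?g (\<lambda>s. F s * exp (of_real z * s))"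
    by (simp add: sums_def contour_integral_sum int contour_integral_lmul
        laplace_kernel_integrable_vertical c)
qed

text \<open>
  The term $n = 0$ is split off, since it converges without a rate. The errors of the others add up to at most
  $6 e^{cz} \sum_{n \ge 1} |b_n|/T^n$, and $T^n \ge T c^{n-1}$ for $T \ge c$ bounds this by a constant over $T$.
\<close>

theorem has_bromwich_integral_inverse_power_series:
  fixes b :: "nat \<Rightarrow> complex" and c z :: real
  assumes c: "c > 0" and z: "z > 0" and b: "summable (\<lambda>n. cmod (b n) / c ^ n)"
    and F: "\<And>s. Re s = c \<Longrightarrow> (\<lambda>n. b n / s ^ Suc n) sums F s"
  shows "has_bromwich_integral (\<lambda>s. F s * exp (of_real z * s))
           (2 * of_real pi * \<i> * (\<Sum>n. b n * of_real z ^ n / fact n)) c"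
proof -
  let ?J = "\<lambda>n T. contour_integral (vertical_segment c T) (laplace_kernel z n)"
  let ?I = "\<lambda>T. contour_integral (vertical_segment c T) (\<lambda>s. F s * exp (of_real z * s))"
  let ?r = "\<lambda>n. 2 * of_real pi * \<i> * (of_real z ^ n / fact n)"
  let ?L = "2 * of_real pi * \<i> * (\<Sum>n. b n * of_real z ^ n / fact n)"
  define M where "M = (\<Sum>n. cmod (b n) / c ^ n)"
  have "(\<lambda>n. 2 * of_real pi * \<i> * (b n * of_real z ^ n / fact n)) sums ?L"
    by (intro sums_mult summable_sums summable_borel_transform[OF c b])
  then have L: "(\<lambda>n. b n * ?r n) sums ?L"
    by (simp add: mult_ac)
  have error: "cmod (?I T - ?L - b 0 * (?J 0 T - 2 * of_real pi * \<i>)) \<le> 6 * exp (c * z) * c * M / T"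
    if T: "T \<ge> c" for T
  proof -
    have sums: "(\<lambda>n. b n * (?J n T - ?r n)) sums (?I T - ?L)"
      using sums_diff[OF vertical_integral_termwise(2)[OF c b F, of T z] L]
      by (simp add: right_diff_distrib)
    have "(\<lambda>n. b (Suc n) * (?J (Suc n) T - ?r (Suc n))) sums
        (?I T - ?L - b 0 * (?J 0 T - ?r 0))"
      using sums by (subst sums_Suc_iff) simp
    then have eq: "?I T - ?L - b 0 * (?J 0 T - 2 * of_real pi * \<i>)
        = (\<Sum>n. b (Suc n) * (?J (Suc n) T - ?r (Suc n)))"
      by (simp add: sums_iff)
    have tail0: "summable (\<lambda>n. cmod (b (Suc n)) / c ^ Suc n)"
      by (rule iffD2[OF summable_Suc_iff b])
    then have tail: "summable (\<lambda>n. 6 * exp (c * z) * c / T * (cmod (b (Suc n)) / c ^ Suc n))"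
      by (rule summable_mult)
    have "cmod (\<Sum>n. b (Suc n) * (?J (Suc n) T - ?r (Suc n)))
        \<le> (\<Sum>n. 6 * exp (c * z) * c / T * (cmod (b (Suc n)) / c ^ Suc n))"
    proof (rule norm_suminf_le[OF _ tail])
      fix n
      have "c ^ n \<le> T ^ n"
        using c T by (intro power_mono) auto
      then have "6 * exp (c * z) / T ^ Suc n \<le> 6 * exp (c * z) / (T * c ^ n)"
        using c T by (intro divide_left_mono) auto
      then have "cmod (?J (Suc n) T - ?r (Suc n)) \<le> 6 * exp (c * z) / (T * c ^ n)"
        using laplace_kernel_vertical_error[OF c T, of z "Suc n"] z by linarith
      then have "cmod (b (Suc n) * (?J (Suc n) T - ?r (Suc n)))
          \<le> cmod (b (Suc n)) * (6 * exp (c * z) / (T * c ^ n))"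
        unfolding norm_mult by (rule mult_left_mono) simp
      also have "\<dots> = 6 * exp (c * z) * c / T * (cmod (b (Suc n)) / c ^ Suc n)"
        using c by simp
      finally show "cmod (b (Suc n) * (?J (Suc n) T - ?r (Suc n)))
          \<le> 6 * exp (c * z) * c / T * (cmod (b (Suc n)) / c ^ Suc n)" .
    qed
    also have "\<dots> = 6 * exp (c * z) * c / T * (\<Sum>n. cmod (b (Suc n)) / c ^ Suc n)"
      by (rule suminf_mult[OF tail0])
    also have "\<dots> \<le> 6 * exp (c * z) * c / T * M"
      using suminf_split_head[OF b] c T by (intro mult_left_mono) (auto simp: M_def)
    finally show ?thesis
      unfolding eq by simp
  qed
  have "((\<lambda>T. ?I T - ?L - b 0 * (?J 0 T - 2 * of_real pi * \<i>)) \<longlongrightarrow> 0) at_top"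
  proof (rule Lim_null_comparison[OF eventually_mono[OF eventually_ge_at_top[of c] error]])
    show "((\<lambda>T. 6 * exp (c * z) * c * M / T) \<longlongrightarrow> 0) at_top"
      by (intro tendsto_divide_0[OF tendsto_const] filterlim_at_top_imp_at_infinity filterlim_ident)
  qed
  moreover have "((\<lambda>T. b 0 * (?J 0 T - 2 * of_real pi * \<i>)) \<longlongrightarrow> 0) at_top"
    using laplace_kernel_vertical_limit_0[OF c z] by (intro tendsto_mult_right_zero LIM_zero)
  ultimately have "((\<lambda>T. ?I T - ?L) \<longlongrightarrow> 0) at_top"
    using tendsto_add by fastforce
  then have "(?I \<longlongrightarrow> ?L) at_top"
    by (rule LIM_zero_cancel)
  then show ?thesis
    unfolding has_bromwich_integral_def using vertical_integral_termwise(1)[OF c b, of F] F by blast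
qed

section \<open>Generating functions of the coefficients\<close>

text \<open>
  The term 1 in the factor $1 + X B_{k-1}$ absorbs the initial values $b_j(k) = -a_j$, as if
  $b_{k-1}(k-1) = 1$; hence one equation serves both the start and the recursion.
\<close>

lemma power_coeff_fps_rec:
  fixes A :: "complex mat"
  assumes A: "A \<in> carrier_mat k k"
  defines "B \<equiv> \<lambda>j. Abs_fps (\<lambda>n. power_coeff A j (n + k))"
  shows "B j = (if j = 0 then 0 else fps_X * B (j - 1))
           - fps_const (coeff (char_poly A) j) * (1 + fps_X * B (k - 1))"
proof (rule fps_ext)
  fix n
  show "fps_nth (B j) n = fps_nth ((if j = 0 then 0 else fps_X * B (j - 1))
           - fps_const (coeff (char_poly A) j) * (1 + fps_X * B (k - 1))) n"
    by (cases n) (auto simp: B_def power_coeff_init[OF A] power_coeff_rec[OF A])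
qed

text \<open>
  With $p_j$ the truncation $\sum_{l \le j} a_l s^l$, this is $w^j p_j(1/w)$ as a polynomial in $w$: the
  coefficients are reversed as if the degree were $j$, even when $a_j = 0$.
\<close>

definition reflected_trunc :: "complex poly \<Rightarrow> nat \<Rightarrow> complex poly" where
  "reflected_trunc p j = (\<Sum>l\<le>j. monom (coeff p l) (j - l))"

lemma reflected_trunc_Suc:
  "reflected_trunc p (Suc j) = monom 1 1 * reflected_trunc p j + [:coeff p (Suc j):]"
  by (auto simp: reflected_trunc_def sum_distrib_left mult_monom Suc_diff_le monom_0 intro!: sum.cong)

lemma poly_reflected_trunc:
  assumes "s \<noteq> 0"
  shows "poly (reflected_trunc p j) (inverse s) = (\<Sum>l\<le>j. coeff p l * s ^ l) / s ^ j"
  using assms by (auto simp: reflected_trunc_def poly_sum poly_monom sum_divide_distrib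
      power_diff field_simps intro!: sum.cong)

text \<open>
  Isolates the leading coefficient of a monic polynomial: in this form the reversed
  characteristic polynomial appears as the factor of $Q$ in the equation for $j = k-1$.
\<close>

lemma reflect_poly_eq_reflected_trunc:
  assumes "degree p = Suc d" "lead_coeff p = 1"
  shows "reflect_poly p = 1 + monom 1 1 * reflected_trunc p d"
proof -
  have "reflect_poly p = reflected_trunc p (Suc d)"
  proof (rule poly_eqI)
    fix n
    have "coeff (reflected_trunc p (Suc d)) n = (\<Sum>l\<le>Suc d. if l = Suc d - n \<and> n \<le> Suc d then coeff p l else 0)"
      unfolding reflected_trunc_def coeff_sum by (intro sum.cong) auto
    also have "\<dots> = coeff (reflect_poly p) n"
      by (auto simp: coeff_reflect_poly assms(1))
    finally show "coeff (reflect_poly p) n = coeff (reflected_trunc p (Suc d)) n" by simp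
  qed
  then show ?thesis
    using assms by (simp add: reflected_trunc_Suc one_pCons)
qed

text \<open>
  The recursion makes each $B_j$ equal to $-Q$ times the reversed truncation, where $Q = 1 + X B_{k-1}$
  is still unknown. Taking $j = k-1$ and inserting the definition of $Q$ gives a linear equation for $Q$,
  solved by the inverse of the reversed characteristic polynomial.
\<close>

lemma power_coeff_fps:
  fixes A :: "complex mat"
  assumes A: "A \<in> carrier_mat k k" and "k \<ge> 1"
  shows "Abs_fps (\<lambda>n. power_coeff A j (n + k)) =
    - (fps_of_poly (reflected_trunc (char_poly A) j) / fps_of_poly (reflect_poly (char_poly A)))"
proof -
  let ?p = "char_poly A"
  define B where "B = (\<lambda>j. Abs_fps (\<lambda>n. power_coeff A j (n + k)))"
  define Q where "Q = 1 + fps_X * B (k - 1)"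
  have rec: "B j = (if j = 0 then 0 else fps_X * B (j - 1)) - fps_const (coeff ?p j) * Q" for j
    unfolding B_def Q_def by (rule power_coeff_fps_rec[OF A])
  have p: "degree ?p = Suc (k - 1)" "lead_coeff ?p = 1"
    using degree_monic_char_poly[OF A] assms(2) by auto
  have B: "B j = - (Q * fps_of_poly (reflected_trunc ?p j))" for j
  proof (induction j)
    case 0
    show ?case
      using rec[of 0]
      by (simp add: reflected_trunc_def fps_of_poly_const monom_0 mult.commute)
  next
    case (Suc j)
    have BS: "B (Suc j) = fps_X * B j - fps_const (coeff ?p (Suc j)) * Q"
      using rec[of "Suc j"] by simp
    show ?case
      unfolding BS Suc.IH by (simp add: reflected_trunc_Suc fps_of_poly_add fps_of_poly_mult
          fps_of_poly_const fps_of_poly_monom algebra_simps)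
  qed
  have "Q * fps_of_poly (reflect_poly ?p) = Q + fps_X * (Q * fps_of_poly (reflected_trunc ?p (k - 1)))"
    unfolding reflect_poly_eq_reflected_trunc[OF p]
    by (simp add: fps_of_poly_add fps_of_poly_mult fps_of_poly_monom algebra_simps)
  also have "\<dots> = Q - fps_X * B (k - 1)"
    using B[of "k - 1"] by simp
  also have "\<dots> = 1"
    by (simp add: Q_def)
  finally have "Q * fps_of_poly (reflect_poly ?p) = 1" .
  then have "Q = inverse (fps_of_poly (reflect_poly ?p))"
    by (intro fps_inverse_unique[symmetric]) (simp add: mult.commute)
  moreover have "fps_nth (fps_of_poly (reflect_poly ?p)) 0 \<noteq> 0"
    using p by simp
  ultimately have "B j = - (fps_of_poly (reflected_trunc ?p j) / fps_of_poly (reflect_poly ?p))"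
    using B[of j] by (simp add: fps_divide_unit mult.commute)
  then show ?thesis
    by (simp add: B_def)
qed

text \<open>
  A quotient of polynomials expands at 0 up to the first zero of its denominator, here
  the reciprocal of an eigenvalue of largest modulus (or infinity).
\<close>

lemma power_coeff_inverse_power_series:
  fixes A :: "complex mat"
  assumes A: "A \<in> carrier_mat k k" and k: "k \<ge> 1" and c: "c > spectral_radius A"
  shows "summable (\<lambda>n. cmod (power_coeff A j (n + k)) / c ^ n)"
    and "\<lbrakk>cmod s \<ge> c; j < k\<rbrakk> \<Longrightarrow> (\<lambda>n. power_coeff A j (n + k) / s ^ Suc n) sums
           - (s ^ (k - j - 1) * (char_poly_trunc A j s / poly (char_poly A) s))"
proof -
  let ?p = "char_poly A"
  let ?N = "fps_of_poly (reflected_trunc ?p j)" and ?D = "fps_of_poly (reflect_poly ?p)"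
  have p: "degree ?p = k" "lead_coeff ?p = 1"
    using degree_monic_char_poly[OF A] by auto
  have root: "cmod \<mu> \<le> spectral_radius A" if "poly ?p \<mu> = 0" for \<mu>
    using that spectral_radius_mem_max(2)[OF A, of "cmod \<mu>"] k eigenvalue_root_char_poly[OF A]
    by (auto simp: spectrum_def)
  have rho: "spectral_radius A \<ge> 0"
    using spectral_radius_mem_max(1)[OF A] k by force
  \<comment> \<open>The spectral radius may be 0, so a positive radius is put between it and $c$ before taking reciprocals.\<close>
  obtain r where r: "spectral_radius A < r" "r < c"
    using dense[OF c] by blast
  have nz: "eval_fps ?D w \<noteq> 0" if "w \<in> eball 0 (ereal (1 / r))" for w
  proof (cases "w = 0")
    case False
    from that have "cmod w < 1 / r"
      by simp
    then have "r < cmod (inverse w)"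
      using False r rho by (simp add: norm_divide field_simps)
    then have "poly ?p (inverse w) \<noteq> 0"
      using root[of "inverse w"] r by auto
    then show ?thesis
      using False by (simp add: poly_reflect_poly_nz)
  qed (use p in auto)
  define B where "B = Abs_fps (\<lambda>n. power_coeff A j (n + k))"
  have B: "B = - (?N / ?D)"
    unfolding B_def by (rule power_coeff_fps[OF A k])
  have R: "ereal (1 / r) \<le> fps_conv_radius B"
    using fps_conv_radius_divide'[of ?N ?D "ereal (1 / r)"] nz r rho by (simp add: B)
  have small: "1 / c < 1 / r"
    using r rho by (simp add: field_simps)
  have "cmod (of_real (1 / c)) < fps_conv_radius B"
    using small r rho by (intro less_le_trans[OF _ R]) (simp add: norm_divide)
  from norm_summable_fps[OF this]
  show "summable (\<lambda>n. cmod (power_coeff A j (n + k)) / c ^ n)"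
    using r rho by (simp add: B_def norm_mult norm_power norm_divide power_one_over)
  assume s: "cmod s \<ge> c" and j: "j < k"
  have s0: "s \<noteq> 0"
    using s r rho by auto
  have "cmod (inverse s) \<le> 1 / c"
    using le_imp_inverse_le[OF s] r rho by (simp add: norm_inverse divide_inverse)
  with small have w: "ereal (cmod (inverse s)) < ereal (1 / r)"
    by simp
  have "s ^ k = s * (s ^ j * s ^ (k - j - 1))"
    using j by (simp flip: power_add power_Suc)
  moreover have "eval_fps ?N (inverse s) = char_poly_trunc A j s / s ^ j"
    using s0 by (simp add: poly_reflected_trunc char_poly_trunc_def atLeast0AtMost)
  moreover have "eval_fps ?D (inverse s) = poly ?p s / s ^ k"
    using s0 p by (simp add: poly_reflect_poly_nz power_inverse divide_inverse mult.commute)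
  moreover have "eval_fps B (inverse s) = - (eval_fps ?N (inverse s) / eval_fps ?D (inverse s))"
    unfolding B
    using eval_fps_divide'[of ?N ?D "ereal (1 / r)" "inverse s"] nz r rho w less_le_trans[OF w R]
    by (simp add: B eval_fps_minus del: eval_fps_of_poly)
  ultimately have "eval_fps B (inverse s) =
      - (char_poly_trunc A j s / s ^ j / (poly ?p s / (s * (s ^ j * s ^ (k - j - 1)))))"
    by (simp only:)
  also have "\<dots> = - (s * (s ^ (k - j - 1) * (char_poly_trunc A j s / poly ?p s)))"
    using s0 by simp
  finally have "eval_fps B (inverse s) = - (s * (s ^ (k - j - 1) * (char_poly_trunc A j s / poly ?p s)))" .
  moreover have "(\<lambda>n. power_coeff A j (n + k) * inverse s ^ n) sums eval_fps B (inverse s)"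
    using sums_eval_fps[of "inverse s" B] less_le_trans[OF w R] by (simp add: B_def)
  ultimately have "(\<lambda>n. power_coeff A j (n + k) * inverse s ^ n / s) sums
      (- (s * (s ^ (k - j - 1) * (char_poly_trunc A j s / poly ?p s))) / s)"
    by (intro sums_divide) simp
  then show "(\<lambda>n. power_coeff A j (n + k) / s ^ Suc n) sums
           - (s ^ (k - j - 1) * (char_poly_trunc A j s / poly (char_poly A) s))"
    using s0 by (simp add: field_simps)
qed

theorem theorem2:
  fixes A :: "complex mat" and k j :: nat and c z :: real
  assumes "A \<in> carrier_mat k k"
    and "j \<le> k - 1" and "k \<ge> 1"
    and "c > spectral_radius A"
    and "z > 0"
  shows "(\<forall>w::complex. summable (\<lambda>n. power_coeff A j (n + k) * w ^ n / fact n)) \<and>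
    bromwich_integrable
      (\<lambda>s. s ^ (k - j - 1) * (char_poly_trunc A j s / poly (char_poly A) s) * exp (of_real z * s)) c \<and>
    power_coeff_gen A j (of_real z) =
      - (1 / (2 * of_real pi * \<i>)) *
        bromwich_integral c
          (\<lambda>s. s ^ (k - j - 1) * (char_poly_trunc A j s / poly (char_poly A) s) * exp (of_real z * s))"
proof -
  let ?b = "\<lambda>n. power_coeff A j (n + k)"
  let ?F = "\<lambda>s. s ^ (k - j - 1) * (char_poly_trunc A j s / poly (char_poly A) s)"
  have c: "c > 0"
    using spectral_radius_mem_max(1)[OF assms(1)] assms(3,4) by (auto intro: le_less_trans[OF norm_ge_zero])
  note b = power_coeff_inverse_power_series[OF assms(1,3,4), where j = j]
  have "(\<lambda>n. - ?b n / s ^ Suc n) sums ?F s" if "Re s = c" for s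
    using sums_minus[OF b(2)[where s = s]] complex_Re_le_cmod[of s] that assms(2,3) by simp
  then have "has_bromwich_integral (\<lambda>s. ?F s * exp (of_real z * s))
           (2 * of_real pi * \<i> * (\<Sum>n. - ?b n * of_real z ^ n / fact n)) c"
    by (intro has_bromwich_integral_inverse_power_series c assms(5)) (use b(1) in simp_all)
  moreover have summable: "summable (\<lambda>n. ?b n * w ^ n / fact n)" for w
    by (rule summable_borel_transform[OF c b(1)])
  moreover have "(\<Sum>n. - ?b n * of_real z ^ n / fact n) = - power_coeff_gen A j (of_real z)"
    using suminf_minus[OF summable] assms(1) by (simp add: power_coeff_gen_def)
  ultimately show ?thesis
    using bromwich_integral_unique unfolding bromwich_integrable_def by force
qed

end
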